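(* For any set $X$ and any subgroup $G$ of the symmetric group $S(X)$ with $S_\omega(X)\subset G$, the Zariski and Markov topologies on $G$ coincide: $\mathfrak Z_G=\mathfrak M_G$.
   Context: $S(X)$ is the group of all bijections of $X$ under composition; $S_\omega(X)\subset S(X)$ is the subgroup of permutations $f$ with finite support $\{x\in X:f(x)\ne x\}$. For a group $G$ with identity $1_G$, the Zariski topology $\mathfrak Z_G$ is generated by the sub-base consisting of the sets $\{x\in G: x^{\varepsilon_1}g_1x^{\varepsilon_2}g_2\cdots x^{\varepsilon_n}g_n\ne 1_G\}$, where $n\in\mathbb N$, $g_1,\dots,g_n\in G$, $\varepsilon_1,\dots,\varepsilon_n\in\{-1,1\}$. The Markov topology $\mathfrak M_G$ is the intersection of all Hausdorff group topologies on $G$ (a group topology is a topology turning $G$ into a topological group). *)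

theory Defs
  imports "HOL-Algebra.Bij" "HOL-Analysis.Abstract_Topology"
    "HOL-Analysis.Abstract_Topological_Spaces"
begin

text \<open>
  The symmetric group of \<open>X\<close> is \<^const>\<open>BijGroup\<close> \<open>X\<close>, whose elements are the bijections of \<open>X\<close>
  represented as functions that are \<^const>\<open>undefined\<close> outside \<open>X\<close>.
\<close>

definition finitary_perms :: "'a set \<Rightarrow> ('a \<Rightarrow> 'a) set"
  where "finitary_perms X = {f \<in> carrier (BijGroup X). finite {x \<in> X. f x \<noteq> x}}"

text \<open>
  The list \<open>[(e\<^sub>1, g\<^sub>1), \<dots>, (e\<^sub>n, g\<^sub>n)]\<close> encodes the word
  \<open>x\<^bsup>e\<^sub>1\<^esup> g\<^sub>1 \<dots> x\<^bsup>e\<^sub>n\<^esup> g\<^sub>n\<close> in the variable \<open>x\<close>.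
\<close>

fun word_value :: "('g, 'm) monoid_scheme \<Rightarrow> (int \<times> 'g) list \<Rightarrow> 'g \<Rightarrow> 'g"
  where
    "word_value G [] x = \<one>\<^bsub>G\<^esub>"
  | "word_value G ((e, g) # w) x = (x [^]\<^bsub>G\<^esub> e \<otimes>\<^bsub>G\<^esub> g) \<otimes>\<^bsub>G\<^esub> word_value G w x"

definition zariski_subbase :: "('g, 'm) monoid_scheme \<Rightarrow> 'g set set"
  where "zariski_subbase G =
    {{x \<in> carrier G. word_value G w x \<noteq> \<one>\<^bsub>G\<^esub>} |w. w \<noteq> [] \<and> set w \<subseteq> {-1, 1} \<times> carrier G}"

text \<open>
  The whole group is the empty intersection of subbasic sets. It is inserted explicitly because
  \<^const>\<open>topology_generated_by\<close> takes the union of the generating family as the underlying space,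
  and for the trivial group the only subbasic set is empty.
\<close>

definition zariski_topology :: "('g, 'm) monoid_scheme \<Rightarrow> 'g topology"
  where "zariski_topology G = topology_generated_by (insert (carrier G) (zariski_subbase G))"

definition group_topology :: "('g, 'm) monoid_scheme \<Rightarrow> 'g topology \<Rightarrow> bool"
  where "group_topology G T \<longleftrightarrow>
    topspace T = carrier G \<and>
    continuous_map (prod_topology T T) T (\<lambda>(x, y). x \<otimes>\<^bsub>G\<^esub> y) \<and>
    continuous_map T T (\<lambda>x. inv\<^bsub>G\<^esub> x)"

definition markov_topology :: "('g, 'm) monoid_scheme \<Rightarrow> 'g topology"
  where "markov_topology G = topology (\<lambda>U. U \<subseteq> carrier G \<and>
    (\<forall>T. group_topology G T \<and> Hausdorff_space T \<longrightarrow> openin T U))"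

text \<open>The family of sets above is indeed a topology.\<close>

lemma openin_markov_topology:
  "openin (markov_topology G) U \<longleftrightarrow> U \<subseteq> carrier G \<and>
    (\<forall>T. group_topology G T \<and> Hausdorff_space T \<longrightarrow> openin T U)"
proof -
  have "istopology (\<lambda>U. U \<subseteq> carrier G \<and>
    (\<forall>T. group_topology G T \<and> Hausdorff_space T \<longrightarrow> openin T U))"
    unfolding istopology_def by blast
  then show ?thesis
    unfolding markov_topology_def by (simp add: topology_inverse')
qed

end

theory Submission
  imports Defs
begin

text \<open>
  Both topologies coincide with the topology of pointwise convergence on the discrete set \<open>X\<close>.
  It is a Hausdorff group topology, so it contains the Markov topology, and word maps are continuous
  in every group topology, so the Zariski topology is contained in the Markov topology.
  It remains to see that \<open>{g. g a = c}\<close> is Zariski open. Let \<open>g\<close> be a member. The condition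
  \<open>(h t h\<^sup>-\<^sup>1 s)\<^sup>2 \<noteq> 1\<close>, with \<open>t = (a b)\<close> and \<open>s = (c d)\<close>, says that the transpositions
  \<open>(h a, h b)\<close> and \<open>(c d)\<close> do not commute. Impose it for three points \<open>b\<close> and two points \<open>d\<close> such that
  \<open>g b \<noteq> d\<close>, which makes it true for \<open>g\<close>. If \<open>h\<close> satisfies all six conditions and \<open>h a \<noteq> c\<close>,
  then \<open>h a \<noteq> d\<close> for one of the two \<open>d\<close>, and \<open>h\<close> maps all three points \<open>b\<close> into \<open>{c, d}\<close>,
  which is absurd. If \<open>X\<close> is finite, then \<open>G\<close> is finite and its Zariski topology, being \<open>T\<^sub>1\<close>, is
  discrete.
\<close>

section \<open>The Zariski topology and group topologies\<close>

lemma topspace_zariski_topology [simp]: "topspace (zariski_topology G) = carrier G"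
  by (auto simp: zariski_topology_def zariski_subbase_def)

lemma openin_zariski_topology_word:
  assumes "w \<noteq> []" "set w \<subseteq> {-1, 1} \<times> carrier G"
  shows "openin (zariski_topology G) {x \<in> carrier G. word_value G w x \<noteq> \<one>\<^bsub>G\<^esub>}"
  unfolding zariski_topology_def
  by (rule topology_generated_by_Basis) (use assms in \<open>auto simp: zariski_subbase_def\<close>)

context group
begin

lemma int_pow_minus_1: "x \<in> carrier G \<Longrightarrow> x [^] (-1::int) = inv x"
  using int_pow_neg[of x 1] by simp

text \<open>When \<open>h t h^-1\<close> and \<open>s\<close> are involutions, this square is their
  commutator, so it equals one exactly when they commute.\<close>

lemma word_value_conj_mult_squared:
  assumes "h \<in> carrier G" "t \<in> carrier G" "s \<in> carrier G"
  shows "word_value G [(1, t), (-1, s), (1, t), (-1, s)] h =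
    (h \<otimes> t \<otimes> inv h \<otimes> s) \<otimes> (h \<otimes> t \<otimes> inv h \<otimes> s)"
  using assms by (simp add: int_pow_minus_1 m_assoc)

text \<open>The one-letter word with coefficient \<open>inv g\<close> takes the value one only at
  \<open>g\<close>, so the complement of a point is subbasic.\<close>

lemma t1_space_zariski_topology: "t1_space (zariski_topology G)"
  unfolding t1_space_closedin_singleton
proof
  fix g assume "g \<in> topspace (zariski_topology G)"
  then have g: "g \<in> carrier G" by simp
  have "openin (zariski_topology G) {x \<in> carrier G. word_value G [(1, inv g)] x \<noteq> \<one>}"
    by (rule openin_zariski_topology_word) (use g in auto)
  also have "{x \<in> carrier G. word_value G [(1, inv g)] x \<noteq> \<one>} = carrier G - {g}"
    using g inv_solve_right'[of \<one> _ g] by auto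
  finally show "closedin (zariski_topology G) {g}"
    using g by (simp add: closedin_def)
qed

lemma continuous_map_mult:
  assumes "group_topology G T" "continuous_map S T f" "continuous_map S T g"
  shows "continuous_map S T (\<lambda>x. f x \<otimes> g x)"
proof -
  have "continuous_map (prod_topology T T) T (\<lambda>(x, y). x \<otimes> y)"
    using assms(1) by (simp add: group_topology_def)
  from continuous_map_compose[OF continuous_map_pairedI[OF assms(2,3)] this]
  show ?thesis by (simp add: o_def)
qed

lemma continuous_map_word_value:
  assumes T: "group_topology G T" and w: "set w \<subseteq> {-1, 1} \<times> carrier G"
  shows "continuous_map T T (word_value G w)"
  using w
proof (induction w)
  case Nil
  show ?case using T by (simp add: group_topology_def)
next
  case (Cons p w)
  obtain e g where p: "p = (e, g)" by (cases p)
  have top: "topspace T = carrier G" and inv: "continuous_map T T (\<lambda>x. inv x)"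
    using T by (auto simp: group_topology_def)
  have eg: "e = -1 \<or> e = 1" "g \<in> carrier G" and IH: "continuous_map T T (word_value G w)"
    using Cons p by auto
  have "continuous_map T T (\<lambda>x. x [^] e)"
    using eg(1)
  proof
    assume "e = -1"
    then show ?thesis
      using continuous_map_eq[OF inv, of "\<lambda>x. x [^] e"] by (simp add: top int_pow_minus_1)
  next
    assume "e = 1"
    then show ?thesis
      using continuous_map_eq[OF continuous_map_id, of T "\<lambda>x. x [^] e"] by (simp add: top)
  qed
  then show ?case
    using IH eg(2) by (simp add: p continuous_map_mult[OF T] top)
qed

text \<open>A subbasic set is the preimage of the complement of the identity under a continuous word
  map. The Hausdorff property serves to make that complement open.\<close>

lemma zariski_coarser_group_topology:
  assumes T: "group_topology G T" "Hausdorff_space T" and U: "openin (zariski_topology G) U"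
  shows "openin T U"
proof -
  have top: "topspace T = carrier G"
    using T(1) by (simp add: group_topology_def)
  have sub: "openin T V" if V: "V \<in> insert (carrier G) (zariski_subbase G)" for V
    using V
  proof
    assume "V = carrier G"
    then show ?thesis using openin_topspace[of T] by (simp add: top)
  next
    assume "V \<in> zariski_subbase G"
    then obtain w where w: "set w \<subseteq> {-1, 1} \<times> carrier G"
      and V: "V = {x \<in> carrier G. word_value G w x \<noteq> \<one>}"
      by (auto simp: zariski_subbase_def)
    have "closedin T {\<one>}"
      using Hausdorff_imp_t1_space[OF T(2)] by (simp add: t1_space_closedin_singleton top)
    then have "openin T (topspace T - {\<one>})" by blast
    from openin_continuous_map_preimage[OF continuous_map_word_value[OF T(1) w] this]
    have "openin T {x \<in> topspace T. word_value G w x \<in> topspace T - {\<one>}}" .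
    also have "{x \<in> topspace T. word_value G w x \<in> topspace T - {\<one>}} = V"
      using continuous_map_image_subset_topspace[OF continuous_map_word_value[OF T(1) w]]
      by (auto simp: V top)
    finally show ?thesis .
  qed
  have "generate_topology_on (insert (carrier G) (zariski_subbase G)) U"
    using U unfolding zariski_topology_def by (rule openin_topology_generated_by)
  then show ?thesis
    by induction (use sub in auto)
qed

end

section \<open>Permutation groups\<close>

locale permutation_group =
  fixes X :: "'a set" and G :: "('a \<Rightarrow> 'a) set"
  assumes subgroup: "subgroup G (BijGroup X)"
begin

abbreviation H where "H \<equiv> BijGroup X\<lparr>carrier := G\<rparr>"

text \<open>The product topology lives on functions that are \<open>undefined\<close> outside
  \<open>X\<close>, which matches the representation of permutations in
  \<open>BijGroup X\<close>.\<close>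

definition pointwise_topology :: "('a \<Rightarrow> 'a) topology"
  where "pointwise_topology = subtopology (product_topology (\<lambda>_. discrete_topology X) X) G"

sublocale H: group H
  by (rule subgroup.subgroup_is_group[OF subgroup group_BijGroup])

lemma mem_Bij: "f \<in> G \<Longrightarrow> f \<in> Bij X"
  using subgroup.subset[OF subgroup] by (auto simp: BijGroup_def)

lemma subset_PiE: "G \<subseteq> (\<Pi>\<^sub>E i\<in>X. X)"
  using mem_Bij by (auto simp: PiE_def Bij_imp_extensional dest: Bij_imp_funcset)

lemma apply_mem: "f \<in> G \<Longrightarrow> x \<in> X \<Longrightarrow> f x \<in> X"
  using subset_PiE by blast

lemma apply_eq_iff: "f \<in> G \<Longrightarrow> x \<in> X \<Longrightarrow> y \<in> X \<Longrightarrow> f x = f y \<longleftrightarrow> x = y"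
  using mem_Bij[of f] by (auto simp: Bij_def bij_betw_def inj_on_def)

lemma apply_mult: "f \<in> G \<Longrightarrow> g \<in> G \<Longrightarrow> x \<in> X \<Longrightarrow> (f \<otimes>\<^bsub>H\<^esub> g) x = f (g x)"
  by (simp add: BijGroup_def mem_Bij compose_def)

lemma apply_one: "x \<in> X \<Longrightarrow> \<one>\<^bsub>H\<^esub> x = x"
  by (simp add: BijGroup_def)

lemma perm_eqI: "f \<in> G \<Longrightarrow> g \<in> G \<Longrightarrow> (\<And>x. x \<in> X \<Longrightarrow> f x = g x) \<Longrightarrow> f = g"
  by (rule PiE_ext[OF subsetD[OF subset_PiE] subsetD[OF subset_PiE]])

lemma inv_mem: "f \<in> G \<Longrightarrow> inv\<^bsub>H\<^esub> f \<in> G"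
  using H.inv_closed by simp

text \<open>Injectivity of \<open>f\<close> together with \<open>f (inv f x) = x\<close> gives this,
  with no explicit formula for the inverse.\<close>

lemma inv_apply_eq_iff:
  assumes "f \<in> G" "x \<in> X" "y \<in> X"
  shows "(inv\<^bsub>H\<^esub> f) x = y \<longleftrightarrow> f y = x"
proof -
  have "(f \<otimes>\<^bsub>H\<^esub> inv\<^bsub>H\<^esub> f) x = x"
    using assms by (subst H.r_inv) (simp_all add: apply_one[simplified])
  then have "f ((inv\<^bsub>H\<^esub> f) x) = x"
    using assms by (simp only: apply_mult inv_mem)
  then show ?thesis
    using assms apply_eq_iff[of f "(inv\<^bsub>H\<^esub> f) x" y] by (auto simp: apply_mem inv_mem)
qed

section \<open>Pointwise convergence as a Hausdorff group topology\<close>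

lemma topspace_pointwise_topology [simp]: "topspace pointwise_topology = G"
  using subset_PiE by (auto simp: pointwise_topology_def)

text \<open>Continuity can be tested on singletons of each coordinate, because every subset of the
  discrete factor is a union of singletons.\<close>

lemma continuous_map_pointwise_topology:
  assumes "\<And>x. x \<in> topspace S \<Longrightarrow> f x \<in> G"
    and "\<And>a c. a \<in> X \<Longrightarrow> c \<in> X \<Longrightarrow> openin S {x \<in> topspace S. f x a = c}"
  shows "continuous_map S pointwise_topology f"
proof -
  have "continuous_map S (discrete_topology X) (\<lambda>x. f x a)" if a: "a \<in> X" for a
    unfolding continuous_map_def
  proof (intro conjI allI impI)
    show "(\<lambda>x. f x a) \<in> topspace S \<rightarrow> topspace (discrete_topology X)"
      using assms(1) a by (auto simp: apply_mem)
    fix U assume "openin (discrete_topology X) U"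
    then have "U \<subseteq> X" by simp
    then have "openin S (\<Union>c\<in>U. {x \<in> topspace S. f x a = c})"
      using assms(2) a by blast
    also have "(\<Union>c\<in>U. {x \<in> topspace S. f x a = c}) = {x \<in> topspace S. f x a \<in> U}"
      by auto
    finally show "openin S {x \<in> topspace S. f x a \<in> U}" .
  qed
  moreover have "f ` topspace S \<subseteq> extensional X"
    using assms(1) subset_PiE by (auto simp: PiE_def)
  ultimately show ?thesis
    using assms(1)
    by (auto simp: pointwise_topology_def continuous_map_in_subtopology continuous_map_componentwise)
qed

lemma openin_pointwise_topology:
  assumes "a \<in> X" "c \<in> X"
  shows "openin pointwise_topology {f \<in> G. f a = c}"
proof -
  have "continuous_map pointwise_topology (discrete_topology X) (\<lambda>f. f a)"
    unfolding pointwise_topology_def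
    by (intro continuous_map_from_subtopology continuous_map_product_projection assms)
  from openin_continuous_map_preimage[OF this, of "{c}"] assms(2) show ?thesis
    by simp
qed

lemma Hausdorff_pointwise_topology: "Hausdorff_space pointwise_topology"
  by (simp add: pointwise_topology_def Hausdorff_space_subtopology Hausdorff_space_product_topology)

lemma group_topology_pointwise_topology: "group_topology H pointwise_topology"
proof -
  have "continuous_map (prod_topology pointwise_topology pointwise_topology) pointwise_topology
      (\<lambda>(f, g). f \<otimes>\<^bsub>H\<^esub> g)"
  proof (rule continuous_map_pointwise_topology)
    fix p assume "p \<in> topspace (prod_topology pointwise_topology pointwise_topology)"
    then show "(case p of (f, g) \<Rightarrow> f \<otimes>\<^bsub>H\<^esub> g) \<in> G"
      using H.m_closed by auto
  next
    fix a c assume ac: "a \<in> X" "c \<in> X"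
    \<comment> \<open>The preimage is split according to the intermediate value
      \<open>b = g a\<close>; each piece is an open rectangle.\<close>
    have "openin (prod_topology pointwise_topology pointwise_topology)
        (\<Union>b\<in>X. {f \<in> G. f b = c} \<times> {g \<in> G. g a = b})"
      using ac by (intro openin_Union ballI) (auto simp: openin_prod_Times_iff openin_pointwise_topology)
    also have "(\<Union>b\<in>X. {f \<in> G. f b = c} \<times> {g \<in> G. g a = b}) =
        {p \<in> topspace (prod_topology pointwise_topology pointwise_topology).
          (case p of (f, g) \<Rightarrow> f \<otimes>\<^bsub>H\<^esub> g) a = c}"
      using ac(1) by (auto simp: apply_mem apply_mult[simplified])
    finally show "openin (prod_topology pointwise_topology pointwise_topology) \<dots>" .
  qed
  moreover have "continuous_map pointwise_topology pointwise_topology (\<lambda>f. inv\<^bsub>H\<^esub> f)"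
  proof (rule continuous_map_pointwise_topology)
    fix a c assume ac: "a \<in> X" "c \<in> X"
    then have "{f \<in> topspace pointwise_topology. (inv\<^bsub>H\<^esub> f) a = c} = {f \<in> G. f c = a}"
      by (simp add: inv_apply_eq_iff[OF _ ac] cong: conj_cong)
    then show "openin pointwise_topology {f \<in> topspace pointwise_topology. (inv\<^bsub>H\<^esub> f) a = c}"
      using ac by (simp add: openin_pointwise_topology)
  qed (simp add: inv_mem)
  ultimately show ?thesis
    by (simp add: group_topology_def)
qed

end

section \<open>Point evaluations are Zariski continuous\<close>

abbreviation transp :: "'a \<Rightarrow> 'a \<Rightarrow> 'a \<Rightarrow> 'a"
  where "transp \<equiv> Transposition.transpose"

locale finitary_permutation_group = permutation_group +
  assumes finitary: "finitary_perms X \<subseteq> G"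
begin

text \<open>The support lies in \<open>{a, b}\<close>. The assumption that \<open>G\<close> contains
  all finitary permutations enters the argument here.\<close>

lemma restrict_transp_mem:
  assumes "a \<in> X" "b \<in> X"
  shows "restrict (transp a b) X \<in> G"
proof -
  have "bij_betw (restrict (transp a b) X) X X"
    by (rule bij_betw_byWitness[where f' = "transp a b"])
      (use assms in \<open>auto simp: Transposition.transpose_def\<close>)
  moreover have "finite {x \<in> X. restrict (transp a b) X x \<noteq> x}"
    by (rule finite_subset[of _ "{a, b}"]) (auto simp: Transposition.transpose_def)
  ultimately have "restrict (transp a b) X \<in> finitary_perms X"
    by (simp add: finitary_perms_def BijGroup_def Bij_def)
  with finitary show ?thesis by blast
qed

text \<open>This is the commutator of \<open>h t h^-1\<close> and \<open>s\<close>. As both are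
  involutions, no inverses of them appear, and the word has the shape required in the
  subbase.\<close>

definition comm_word :: "'a \<Rightarrow> 'a \<Rightarrow> 'a \<Rightarrow> 'a \<Rightarrow> (int \<times> ('a \<Rightarrow> 'a)) list"
  where "comm_word a b c d =
    (let t = restrict (transp a b) X; s = restrict (transp c d) X
     in [(1, t), (-1, s), (1, t), (-1, s)])"

lemma openin_comm_word:
  assumes "a \<in> X" "b \<in> X" "c \<in> X" "d \<in> X"
  shows "openin (zariski_topology H) {h \<in> G. word_value H (comm_word a b c d) h \<noteq> \<one>\<^bsub>H\<^esub>}"
  using openin_zariski_topology_word[of "comm_word a b c d" H]
  by (simp add: comm_word_def Let_def restrict_transp_mem assms)

text \<open>Conjugating the transposition of \<open>a\<close> and \<open>b\<close> by
  \<open>h\<close> gives the transposition of \<open>h a\<close> and \<open>h b\<close>; the word is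
  then evaluated point by point.\<close>

lemma word_value_comm_word:
  assumes h: "h \<in> G" and X: "a \<in> X" "b \<in> X" "c \<in> X" "d \<in> X"
  shows "word_value H (comm_word a b c d) h = \<one>\<^bsub>H\<^esub> \<longleftrightarrow>
    (\<forall>z\<in>X. transp (h a) (h b) (transp c d (transp (h a) (h b) (transp c d z))) = z)"
proof -
  define t where "t = restrict (transp a b) X"
  define s where "s = restrict (transp c d) X"
  define p where "p = h \<otimes>\<^bsub>H\<^esub> t \<otimes>\<^bsub>H\<^esub> inv\<^bsub>H\<^esub> h"
  have G: "t \<in> G" "s \<in> G" "h \<in> G" "inv\<^bsub>H\<^esub> h \<in> G"
    using h X by (auto simp: t_def s_def restrict_transp_mem inv_mem)
  have cl: "f \<otimes>\<^bsub>H\<^esub> g \<in> G" if "f \<in> G" "g \<in> G" for f g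
    using H.m_closed[of f g] that by simp
  have "p \<in> G" using G cl by (simp add: p_def)
  have p: "p y = transp (h a) (h b) y" if y: "y \<in> X" for y
  proof -
    obtain x where x: "x \<in> X" "(inv\<^bsub>H\<^esub> h) y = x"
      using apply_mem[OF G(4) y] by blast
    then have hx: "h x = y"
      using inv_apply_eq_iff[OF h y] by blast
    have "p y = h (t x)"
      using y by (simp only: p_def apply_mult cl G apply_mem x)
    \<comment> \<open>With \<open>y = h x\<close>, injectivity of \<open>h\<close> reduces both
      sides to the cases \<open>x = a\<close>, \<open>x = b\<close> and neither.\<close>
    also have "\<dots> = transp (h a) (h b) y"
      using x(1) X by (auto simp: t_def hx[symmetric] Transposition.transpose_def apply_eq_iff[OF h])
    finally show ?thesis .
  qed
  have s: "s y = transp c d y" if "y \<in> X" for y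
    using that by (simp add: s_def)
  have word: "word_value H (comm_word a b c d) h = p \<otimes>\<^bsub>H\<^esub> s \<otimes>\<^bsub>H\<^esub> (p \<otimes>\<^bsub>H\<^esub> s)"
    unfolding comm_word_def Let_def p_def t_def[symmetric] s_def[symmetric]
    by (rule H.word_value_conj_mult_squared) (use G in simp_all)
  have eval: "(p \<otimes>\<^bsub>H\<^esub> s \<otimes>\<^bsub>H\<^esub> (p \<otimes>\<^bsub>H\<^esub> s)) z =
      transp (h a) (h b) (transp c d (transp (h a) (h b) (transp c d z)))"
    if z: "z \<in> X" for z
  proof -
    have 1: "s z \<in> X" using apply_mem[OF G(2) z] .
    have 2: "p (s z) \<in> X" using apply_mem[OF \<open>p \<in> G\<close> 1] .
    have 3: "s (p (s z)) \<in> X" using apply_mem[OF G(2) 2] .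
    have "(p \<otimes>\<^bsub>H\<^esub> s \<otimes>\<^bsub>H\<^esub> (p \<otimes>\<^bsub>H\<^esub> s)) z = p (s (p (s z)))"
      using z 1 2 G \<open>p \<in> G\<close> by (simp only: apply_mult cl)
    also have "\<dots> = transp (h a) (h b) (transp c d (transp (h a) (h b) (transp c d z)))"
      using p[OF 3] s[OF 2] p[OF 1] s[OF z] by simp
    finally show ?thesis .
  qed
  have mem: "p \<otimes>\<^bsub>H\<^esub> s \<otimes>\<^bsub>H\<^esub> (p \<otimes>\<^bsub>H\<^esub> s) \<in> G" "\<one>\<^bsub>H\<^esub> \<in> G"
    using G \<open>p \<in> G\<close> cl H.one_closed by auto
  have "p \<otimes>\<^bsub>H\<^esub> s \<otimes>\<^bsub>H\<^esub> (p \<otimes>\<^bsub>H\<^esub> s) = \<one>\<^bsub>H\<^esub> \<longleftrightarrow>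
      (\<forall>z\<in>X. (p \<otimes>\<^bsub>H\<^esub> s \<otimes>\<^bsub>H\<^esub> (p \<otimes>\<^bsub>H\<^esub> s)) z = \<one>\<^bsub>H\<^esub> z)"
    using perm_eqI[OF mem] by metis
  then show ?thesis
    by (simp only: word apply_one eval cong: ball_cong)
qed

lemma openin_zariski_topology_eval:
  assumes a: "a \<in> X" and c: "c \<in> X"
  shows "openin (zariski_topology H) {g \<in> G. g a = c}"
proof (cases "finite X")
  case True
  have "finite G"
    using subset_PiE finite_PiE[OF True, of "\<lambda>_. X"] True by (blast intro: finite_subset)
  \<comment> \<open>In a \<open>T1\<close> space every finite set is closed, in particular this
    complement.\<close>
  then have "closedin (zariski_topology H) (G - {g \<in> G. g a = c})"
    by (intro t1_space_closedin_finite[THEN iffD1, rule_format, OF H.t1_space_zariski_topology]) auto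
  moreover have "G - (G - {g \<in> G. g a = c}) = {g \<in> G. g a = c}" by blast
  ultimately show ?thesis by (simp add: closedin_def)
next
  case False
  have "\<exists>U. openin (zariski_topology H) U \<and> g \<in> U \<and> U \<subseteq> {g \<in> G. g a = c}"
    if g: "g \<in> {g \<in> G. g a = c}" for g
  proof -
    obtain B where B: "B \<subseteq> X - {a}" "finite B" "card B = 3"
      using infinite_arbitrarily_large[of "X - {a}" 3] False by auto
    \<comment> \<open>Excluding \<open>c\<close> and the image of \<open>B\<close> keeps every
      \<open>d\<close> fixed by the transposition of \<open>g a = c\<close> and
      \<open>g b\<close>.\<close>
    obtain D where D: "D \<subseteq> X - insert c (g ` B)" "finite D" "card D = 2"
      using infinite_arbitrarily_large[of "X - insert c (g ` B)" 2] False B(2)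
      by (metis Diff_infinite_finite finite_imageI finite_insert)
    define V where "V b d = {h \<in> G. word_value H (comm_word a b c d) h \<noteq> \<one>\<^bsub>H\<^esub>}" for b d
    define U where "U = (\<Inter>b\<in>B. \<Inter>d\<in>D. V b d)"
    have BD: "b \<in> X" "b \<noteq> a" "d \<in> X" "d \<noteq> c" "d \<noteq> g b" if "b \<in> B" "d \<in> D" for b d
      using B(1) D(1) that by auto
    have ne: "B \<noteq> {}" "D \<noteq> {}" using B(3) D(3) by auto
    have "openin (zariski_topology H) U"
      unfolding U_def V_def
      using B(2) D(2) ne a c BD by (intro openin_INT2 openin_comm_word) auto
    moreover have "g \<in> V b d" if bd: "b \<in> B" "d \<in> D" for b d
    proof -
      have "g b \<noteq> c"
        using g a BD[OF bd] apply_eq_iff[of g b a] by auto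
      \<comment> \<open>The point \<open>c\<close> witnesses noncommutation: it goes to
        \<open>d\<close>, stays there, returns to \<open>c = g a\<close> and ends at
        \<open>g b\<close>.\<close>
      then have "transp (g a) (g b) (transp c d (transp (g a) (g b) (transp c d c))) \<noteq> c"
        using g BD[OF bd] by (auto simp: Transposition.transpose_def)
      then show ?thesis
        using g c word_value_comm_word[OF _ a BD(1)[OF bd] c BD(3)[OF bd]] by (auto simp only: V_def mem_Collect_eq)
    qed
    then have "g \<in> U" by (auto simp: U_def)
    moreover have "h \<in> {g \<in> G. g a = c}" if "h \<in> U" for h
    proof -
      have hV: "h \<in> V b d" if "b \<in> B" "d \<in> D" for b d
        using that \<open>h \<in> U\<close> by (auto simp: U_def)
      have h: "h \<in> G" using hV ne by (auto simp: V_def)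
      have "h a = c"
      proof (rule ccontr)
        assume ac: "h a \<noteq> c"
        have "\<not> D \<subseteq> {h a}"
          using D(3) card_mono[of "{h a}" D] by auto
        then obtain d where d: "d \<in> D" "h a \<noteq> d" by blast
        have "h b \<in> {c, d}" if b: "b \<in> B" for b
        proof (rule ccontr)
          assume "h b \<notin> {c, d}"
          \<comment> \<open>Neither \<open>h a\<close> nor \<open>h b\<close> lies in
            \<open>{c, d}\<close>, so the two transpositions are disjoint and commute.\<close>
          then have "\<forall>z\<in>X. transp (h a) (h b) (transp c d (transp (h a) (h b) (transp c d z))) = z"
            using ac d(2) by (auto simp: Transposition.transpose_def)
          then have "h \<notin> V b d"
            using word_value_comm_word[OF h a BD(1)[OF b d(1)] c BD(3)[OF b d(1)]]
            unfolding V_def by blast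
          with hV[OF b d(1)] show False by simp
        qed
        then have "h ` B \<subseteq> {c, d}" by blast
        then have "card (h ` B) \<le> 2"
          using card_mono[of "{c, d}" "h ` B"] by (simp add: card_insert_if split: if_splits)
        moreover have "inj_on h B"
          using B(1) apply_eq_iff[OF h] by (fastforce simp: inj_on_def)
        ultimately show False
          using B(3) by (simp add: card_image)
      qed
      with h show ?thesis by simp
    qed
    ultimately show ?thesis by blast
  qed
  then show ?thesis
    by (subst openin_subopen) blast
qed

text \<open>Since all evaluation conditions are Zariski open, the identity map is continuous from
  the Zariski to the pointwise topology.\<close>

lemma pointwise_coarser_zariski:
  assumes "openin pointwise_topology U"
  shows "openin (zariski_topology H) U"
proof -
  have "continuous_map (zariski_topology H) pointwise_topology (\<lambda>g. g)"
    by (rule continuous_map_pointwise_topology) (simp_all add: openin_zariski_topology_eval)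
  from openin_continuous_map_preimage[OF this assms]
  have "openin (zariski_topology H) {g \<in> G. g \<in> U}" by simp
  moreover have "{g \<in> G. g \<in> U} = U"
    using openin_subset[OF assms] by auto
  ultimately show ?thesis by simp
qed

end

theorem corollary3p1:
  fixes X :: "'a set" and G :: "('a \<Rightarrow> 'a) set"
  assumes "subgroup G (BijGroup X)"
    and "finitary_perms X \<subseteq> G"
  shows "zariski_topology (BijGroup X\<lparr>carrier := G\<rparr>) = markov_topology (BijGroup X\<lparr>carrier := G\<rparr>)"
proof -
  interpret finitary_permutation_group X G
    by (intro finitary_permutation_group.intro permutation_group.intro
        finitary_permutation_group_axioms.intro assms)
  show ?thesis
    unfolding topology_eq openin_markov_topology
  proof (intro allI iffI conjI impI)
    fix U assume U: "openin (zariski_topology H) U"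
    show "U \<subseteq> carrier H"
      using openin_subset[OF U] by simp
    show "openin T U" if "group_topology H T \<and> Hausdorff_space T" for T
      using that U by (blast intro: H.zariski_coarser_group_topology)
  next
    fix U assume "U \<subseteq> carrier H \<and> (\<forall>T. group_topology H T \<and> Hausdorff_space T \<longrightarrow> openin T U)"
    then show "openin (zariski_topology H) U"
      \<comment> \<open>The Markov condition is applied to a single Hausdorff group topology, that
        of pointwise convergence.\<close>
      using group_topology_pointwise_topology Hausdorff_pointwise_topology
      by (blast intro: pointwise_coarser_zariski)
  qed
qed

end
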